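(* For each integer $b\geq 5$ there exists a pair of cospectral connected $b$-regular graphs $G$ and $G'$ such that one of them has a perfect matching and the other one does not.
   Context: All graphs are finite, simple and undirected. Two graphs are cospectral if their adjacency matrices have the same spectrum (the same eigenvalues with the same multiplicities). A graph is $b$-regular if every vertex has degree exactly $b$. A perfect matching is a set of pairwise disjoint edges covering every vertex. *)

theory Defs
  imports
    "Graph_Theory.Digraph_Component"
    "Jordan_Normal_Form.Spectral_Radius"
begin

text \<open>
  A finite simple undirected graph is a \<open>pair_graph\<close>: a finite vertex set together with a
  finite, symmetric, irreflexive set of ordered pairs of vertices. An undirected edge is thus
  stored as two opposite arcs, and the degree of a vertex is its out-degree.
\<close>

definition undirected_edges :: "'a pair_pre_digraph \<Rightarrow> 'a set set" where
  "undirected_edges G = {{u, v} | u v. (u, v) \<in> parcs G}"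

definition regular_graph :: "nat \<Rightarrow> 'a pair_pre_digraph \<Rightarrow> bool" where
  "regular_graph b G \<longleftrightarrow> (\<forall>v \<in> pverts G. out_degree (with_proj G) v = b)"

definition perfect_matching :: "'a pair_pre_digraph \<Rightarrow> 'a set set \<Rightarrow> bool" where
  "perfect_matching G M \<longleftrightarrow>
     M \<subseteq> undirected_edges G \<and> pairwise disjnt M \<and> (\<forall>v \<in> pverts G. \<exists>e \<in> M. v \<in> e)"

definition has_perfect_matching :: "'a pair_pre_digraph \<Rightarrow> bool" where
  "has_perfect_matching G \<longleftrightarrow> (\<exists>M. perfect_matching G M)"

text \<open>
  Rows and columns are indexed by the vertices in increasing order; any other enumeration
  gives a permutation-similar matrix, with the same spectrum. The entries are taken in the
  complex numbers so that all eigenvalues are accounted for without appeal to symmetry.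
\<close>

definition adjacency_matrix :: "'a :: linorder pair_pre_digraph \<Rightarrow> complex mat" where
  "adjacency_matrix G =
     (let vs = sorted_list_of_set (pverts G); n = card (pverts G)
      in mat n n (\<lambda>(i, j). if (vs ! i, vs ! j) \<in> parcs G then 1 else 0))"

text \<open>
  The multiplicity of an eigenvalue is its multiplicity as a root of the characteristic
  polynomial. Adjacency matrices being real symmetric, it is also the dimension of the
  eigenspace.
\<close>

definition cospectral :: "'a :: linorder pair_pre_digraph \<Rightarrow> 'b :: linorder pair_pre_digraph \<Rightarrow> bool" where
  "cospectral G H \<longleftrightarrow>
     spectrum (adjacency_matrix G) = spectrum (adjacency_matrix H) \<and>
     (\<forall>k \<in> spectrum (adjacency_matrix G).
        Polynomial.order k (char_poly (adjacency_matrix G)) =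
        Polynomial.order k (char_poly (adjacency_matrix H)))"

end

theory Submission
  imports Defs "HOL-Library.Countable"
begin

text \<open>
  Both graphs have \<open>b\<close> gadgets, each the graph \<open>K\<^bsub>b-1,b\<^esub>\<close> with one further edge inside the larger
  side; the \<open>b - 2\<close> vertices of that side whose degree is still \<open>b - 1\<close> are joined to a set \<open>R\<close> of \<open>b\<close>
  vertices. The core has four vertices. For each \<open>i < b\<close> it is split into two pairs, one of them
  containing core vertex \<open>0\<close>; one pair is joined to the \<open>i\<close>-th vertex of \<open>R\<close>, the other to the \<open>i\<close>-th
  vertex of a second set \<open>L\<close>, which lies in a part with \<open>2 b\<close> vertices. The two graphs differ in which
  pair goes to which set, so they are related by Godsil-McKay switching with respect to the core.

  If the pairs containing \<open>0\<close> go to \<open>L\<close>, the core can be matched into \<open>L\<close> and each gadget with its own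
  vertex of \<open>R\<close>. If they go to \<open>R\<close>, removing \<open>R\<close> leaves the \<open>b\<close> odd gadgets and the isolated core
  vertex \<open>0\<close>, so there is no perfect matching by Tutte's condition.
\<close>

section \<open>Graphs on countable vertex types, coded as graphs on natural numbers\<close>

definition coded_graph :: "'a::countable set \<Rightarrow> ('a \<Rightarrow> 'a \<Rightarrow> bool) \<Rightarrow> nat pair_pre_digraph" where
  "coded_graph V E =
     \<lparr>pverts = to_nat ` V, parcs = {(to_nat u, to_nat v) | u v. u \<in> V \<and> v \<in> V \<and> E u v}\<rparr>"

lemma pverts_coded_graph [simp]: "pverts (coded_graph V E) = to_nat ` V"
  by (simp add: coded_graph_def)

lemma parcs_coded_graph_iff [simp]:
  "(to_nat u, to_nat v) \<in> parcs (coded_graph V E) \<longleftrightarrow> u \<in> V \<and> v \<in> V \<and> E u v"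
  by (auto simp: coded_graph_def)

lemma parcs_coded_graphE:
  assumes "(x, y) \<in> parcs (coded_graph V E)"
  obtains u v where "x = to_nat u" "y = to_nat v" "u \<in> V" "v \<in> V" "E u v"
  using assms by (auto simp: coded_graph_def)

lemma pair_graph_coded_graph:
  assumes "finite V" and "\<And>u v. E u v \<Longrightarrow> E v u" and "\<And>u. \<not> E u u"
  shows "pair_graph (coded_graph V E)"
proof
  let ?G = "coded_graph V E"
  show "finite (pverts ?G)" using assms(1) by simp
  have "parcs ?G \<subseteq> to_nat ` V \<times> to_nat ` V" by (auto simp: coded_graph_def)
  then show "finite (parcs ?G)" using assms(1) by (meson finite_SigmaI finite_imageI finite_subset)
  show "symmetric (with_proj ?G)"
    unfolding symmetric_def using assms(2) by (auto simp: coded_graph_def intro!: symI)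
next
  fix e assume "e \<in> parcs (coded_graph V E)"
  then show "fst e \<in> pverts (coded_graph V E)" "snd e \<in> pverts (coded_graph V E)" "fst e \<noteq> snd e"
    using assms(3) by (auto simp: coded_graph_def)
qed

lemma regular_coded_graph:
  assumes "\<And>v. v \<in> V \<Longrightarrow> card {u \<in> V. E v u} = b"
  shows "regular_graph b (coded_graph V E)"
  unfolding regular_graph_def
proof
  fix x assume "x \<in> pverts (coded_graph V E)"
  then obtain v where v: "v \<in> V" "x = to_nat v" by auto
  have "out_arcs (with_proj (coded_graph V E)) x = (\<lambda>u. (x, to_nat u)) ` {u \<in> V. E v u}"
    using v by (auto simp: out_arcs_def elim!: parcs_coded_graphE)
  moreover have "inj_on (\<lambda>u. (x, to_nat u)) {u \<in> V. E v u}" by (auto intro!: inj_onI)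
  ultimately show "out_degree (with_proj (coded_graph V E)) x = b"
    using assms[OF v(1)] by (simp add: out_degree_def card_image)
qed

text \<open>Taking \<open>W\<close> to be the set of vertices reachable from \<open>r\<close> turns
  the closure hypothesis into reachability of all of \<open>V\<close>; symmetry reverses these
  walks. In applications it remains to follow single edges inside an unknown closed set.\<close>

lemma connected_coded_graph:
  assumes "r \<in> V"
    and "\<And>W. r \<in> W \<Longrightarrow> (\<And>u v. u \<in> W \<Longrightarrow> u \<in> V \<Longrightarrow> v \<in> V \<Longrightarrow> E u v \<Longrightarrow> v \<in> W) \<Longrightarrow> V \<subseteq> W"
    and "\<And>u v. E u v \<Longrightarrow> E v u"
  shows "Digraph_Component.connected (with_proj (coded_graph V E))"
proof -
  let ?R = "rtrancl_on (to_nat ` V) (parcs (coded_graph V E))"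
  have "V \<subseteq> {v. (to_nat r, to_nat v) \<in> ?R}"
    using assms(1) by (intro assms(2)) (auto intro: rtrancl_on_into_rtrancl_on)
  then have from_r: "(to_nat r, to_nat v) \<in> ?R" if "v \<in> V" for v using that by auto
  have "sym (parcs (coded_graph V E))"
    using assms(3) by (auto simp: coded_graph_def intro!: symI)
  then have "sym ?R" by (rule rtrancl_on_sym)
  then have R: "(to_nat u, to_nat v) \<in> ?R" if "u \<in> V" "v \<in> V" for u v
    using from_r[OF that(1)] from_r[OF that(2)] by (meson rtrancl_on_trans symD)
  \<comment> \<open>\<open>connected\<close> asks for walks in the symmetric closure, which contains
    the arcs themselves.\<close>
  have "?R \<subseteq> rtrancl_on (to_nat ` V) ((parcs (coded_graph V E))\<^sup>s)"
    by (auto simp: symcl_def intro: rtrancl_on_mono)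
  then show ?thesis
    using R assms(1) unfolding Digraph_Component.connected_conv by auto
qed

text \<open>The matching is given as an involution along edges. Each edge arises from both of its
  ends, and the image, being a set, merges the two.\<close>

lemma has_perfect_matching_coded_graphI:
  assumes "\<And>v. v \<in> V \<Longrightarrow> p v \<in> V" and "\<And>v. v \<in> V \<Longrightarrow> p (p v) = v" and "\<And>v. v \<in> V \<Longrightarrow> E v (p v)"
  shows "has_perfect_matching (coded_graph V E)"
proof -
  let ?M = "(\<lambda>v. {to_nat v, to_nat (p v)}) ` V"
  have "?M \<subseteq> undirected_edges (coded_graph V E)"
    using assms(1,3) by (force simp: undirected_edges_def)
  moreover have "pairwise disjnt ?M"
    unfolding pairwise_image by (auto simp: pairwise_def disjnt_iff assms(2)) (metis assms(2))+
  ultimately show ?thesis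
    unfolding has_perfect_matching_def perfect_matching_def by (intro exI[of _ ?M]) auto
qed

section \<open>Parity and the necessary half of Tutte's condition\<close>

lemma even_card_if_partner_closed:
  assumes G: "pair_graph G" and M: "perfect_matching G M"
    and U: "U \<subseteq> pverts G" and closed: "\<And>e. e \<in> M \<Longrightarrow> e \<inter> U \<noteq> {} \<Longrightarrow> e \<subseteq> U"
  shows "even (card U)"
proof -
  interpret pair_graph G by (rule G)
  have "card e = 2" if "e \<in> M" for e
  proof -
    from that M obtain u v where "e = {u, v}" "(u, v) \<in> parcs G"
      by (auto simp: perfect_matching_def undirected_edges_def)
    then show ?thesis using no_loops' by auto
  qed
  moreover have "U = \<Union> {e \<in> M. e \<subseteq> U}"
    using U M closed by (fastforce simp: perfect_matching_def)
  moreover have "card (\<Union> {e \<in> M. e \<subseteq> U}) = sum card {e \<in> M. e \<subseteq> U}"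
    using M U finite_subset[OF _ pair_finite_verts]
    by (intro card_Union_disjoint) (auto simp: perfect_matching_def pairwise_def)
  ultimately show ?thesis by (metis (no_types, lifting) dvd_refl dvd_sum mem_Collect_eq)
qed

text \<open>A part closed under matching partners is even, so each odd \<open>U j\<close> has a
  vertex matched outside itself, hence into \<open>S\<close>; disjoint parts use different vertices
  of \<open>S\<close>.\<close>

lemma card_odd_parts_le:
  assumes G: "pair_graph G" and "has_perfect_matching G" and "S \<subseteq> pverts G"
    and U: "\<And>j. j \<in> J \<Longrightarrow> U j \<subseteq> pverts G - S" "\<And>j. j \<in> J \<Longrightarrow> odd (card (U j))"
      "disjoint_family_on U J"
    and nbr: "\<And>j u v. j \<in> J \<Longrightarrow> u \<in> U j \<Longrightarrow> (u, v) \<in> parcs G \<Longrightarrow> v \<in> U j \<union> S"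
  shows "card J \<le> card S"
proof -
  interpret pair_graph G by (rule G)
  obtain M where M: "perfect_matching G M"
    using assms(2) by (auto simp: has_perfect_matching_def)
  have "\<exists>s. s \<in> S \<and> (\<exists>u \<in> U j. {u, s} \<in> M)" if j: "j \<in> J" for j
  proof (rule ccontr)
    assume no: "\<nexists>s. s \<in> S \<and> (\<exists>u \<in> U j. {u, s} \<in> M)"
    have "e \<subseteq> U j" if e: "e \<in> M" "e \<inter> U j \<noteq> {}" for e
    proof -
      obtain u v where uv: "e = {u, v}" "(u, v) \<in> parcs G"
        using e(1) M by (auto simp: perfect_matching_def undirected_edges_def)
      then have vu: "(v, u) \<in> parcs G" using graph_symmetric by simp
      show ?thesis
        using e uv no nbr[OF j _ uv(2)] nbr[OF j _ vu] by (auto simp: insert_commute)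
    qed
    then have "even (card (U j))"
      using U(1)[OF j] by (intro even_card_if_partner_closed[OF G M]) auto
    then show False using U(2)[OF j] by simp
  qed
  then obtain s where s: "\<And>j. j \<in> J \<Longrightarrow> s j \<in> S" "\<And>j. j \<in> J \<Longrightarrow> \<exists>u \<in> U j. {u, s j} \<in> M" by metis
  have "inj_on s J"
  proof (rule inj_onI, rule ccontr)
    fix i j assume ij: "i \<in> J" "j \<in> J" "s i = s j" "i \<noteq> j"
    obtain u v where uv: "u \<in> U i" "{u, s i} \<in> M" "v \<in> U j" "{v, s i} \<in> M"
      using s(2) ij by metis
    have "{u, s i} = {v, s i}"
      using M uv(2,4) unfolding perfect_matching_def pairwise_def disjnt_def
      by (metis disjoint_iff insertCI)
    moreover have "U i \<inter> U j = {}" using U(3) ij by (auto simp: disjoint_family_on_def)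
    \<comment> \<open>Equal doubletons force \<open>u = v\<close>, excluded by disjointness, or
      \<open>u = s i\<close>, excluded because \<open>U i\<close> avoids \<open>S\<close>.\<close>
    ultimately show False using uv U(1) s(1) ij by (auto simp: doubleton_eq_iff)
  qed
  then show ?thesis
    using s(1) assms(3) by (intro card_inj_on_le[of s]) (auto intro: finite_subset)
qed

section \<open>Cospectrality and Godsil-McKay switching\<close>

lemma cospectral_if_similar_mat:
  assumes "similar_mat (adjacency_matrix G) (adjacency_matrix H)"
  shows "cospectral G H"
proof -
  have carrier: "adjacency_matrix G \<in> carrier_mat (card (pverts G)) (card (pverts G))"
    "adjacency_matrix H \<in> carrier_mat (card (pverts H)) (card (pverts H))"
    by (auto simp: adjacency_matrix_def Let_def)
  have "char_poly (adjacency_matrix G) = char_poly (adjacency_matrix H)"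
    by (rule char_poly_similar[OF assms])
  then show ?thesis
    unfolding cospectral_def spectrum_def
    by (auto simp: eigenvalue_root_char_poly[OF carrier(1)] eigenvalue_root_char_poly[OF carrier(2)])
qed

text \<open>The matrix of \<open>q\<close> is its own inverse and intertwines the two adjacency
  matrices, so it conjugates one into the other. Stating this with sums over \<open>V\<close> keeps
  the enumeration of the vertices out of applications.\<close>

lemma cospectral_coded_graph_if_intertwined:
  fixes q :: "'a::countable \<Rightarrow> 'a \<Rightarrow> complex"
  assumes "finite V"
    and inv: "\<And>u v. u \<in> V \<Longrightarrow> v \<in> V \<Longrightarrow> (\<Sum>w\<in>V. q u w * q w v) = of_bool (u = v)"
    and comm: "\<And>u v. u \<in> V \<Longrightarrow> v \<in> V \<Longrightarrow>
      (\<Sum>w\<in>V. of_bool (E u w) * q w v) = (\<Sum>w\<in>V. q u w * of_bool (F w v))"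
  shows "cospectral (coded_graph V E) (coded_graph V F)"
proof -
  define vs where "vs = sorted_list_of_set (to_nat ` V)"
  define n where "n = card V"
  define f where "f i = (from_nat (vs ! i) :: 'a)" for i
  have len: "length vs = n" and vs: "set vs = to_nat ` V" "distinct vs"
    using assms(1) by (auto simp: vs_def n_def card_image)
  have nth: "vs ! i \<in> to_nat ` V" if "i < n" for i using that len vs by (metis nth_mem)
  have vs_f: "vs ! i = to_nat (f i)" if "i < n" for i using nth[OF that] by (auto simp: f_def)
  have f_V: "f i \<in> V" if "i < n" for i using nth[OF that] by (auto simp: f_def)
  have inj: "inj_on f {..<n}"
    using vs_f vs(2) len by (auto intro!: inj_onI simp: nth_eq_iff_index_eq[symmetric])
  have "bij_betw f {..<n} V"
    unfolding bij_betw_def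
  proof
    show "f ` {..<n} = V"
      using f_V inj assms(1) by (intro card_subset_eq) (auto simp: card_image n_def)
  qed (rule inj)
  then have sum_f: "(\<Sum>k = 0..<n. g (f k)) = (\<Sum>w\<in>V. g w)" for g :: "'a \<Rightarrow> complex"
    using sum.reindex_bij_betw[of f "{..<n}" V g] by (simp add: atLeast0LessThan)
  have adj: "adjacency_matrix (coded_graph V D) = mat n n (\<lambda>(i, j). of_bool (D (f i) (f j)))" for D
    unfolding adjacency_matrix_def Let_def pverts_coded_graph vs_def[symmetric]
    by (rule eq_matI) (auto simp: n_def[symmetric] card_image vs_f f_V)
  define A where "A = adjacency_matrix (coded_graph V E)"
  define B where "B = adjacency_matrix (coded_graph V F)"
  define Q where "Q = mat n n (\<lambda>(i, j). q (f i) (f j))"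
  have A: "A \<in> carrier_mat n n" and B: "B \<in> carrier_mat n n" and Q: "Q \<in> carrier_mat n n"
    by (auto simp: A_def B_def Q_def adj)
  have QQ: "Q * Q = 1\<^sub>m n"
    by (rule eq_matI) (auto simp: Q_def scalar_prod_def sum_f[of "\<lambda>w. q _ w * q w _"] inv f_V
        inj_on_eq_iff[OF inj])
  have AQ: "A * Q = Q * B"
    by (rule eq_matI) (auto simp: A_def B_def adj Q_def scalar_prod_def f_V
        sum_f[of "\<lambda>w. of_bool (E _ w) * q w _"] sum_f[of "\<lambda>w. q _ w * of_bool (F w _)"] comm)
  have "A = A * (Q * Q)" using A by (simp add: QQ)
  also have "\<dots> = Q * B * Q" using A Q by (simp add: AQ[symmetric])
  finally have "similar_mat A B"
    using A B Q QQ by (intro similar_matI[of A B Q Q n]) auto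
  then show ?thesis by (simp add: A_def B_def cospectral_if_similar_mat)
qed

text \<open>Since \<open>C\<close> has \<open>2 * m\<close> elements, a sum over \<open>C\<close>
  divided by \<open>m\<close> is twice the mean, and \<open>q\<close> sends a function
  \<open>g\<close> on \<open>C\<close> to twice its mean minus \<open>g\<close>. This fixes constant
  functions and complements 0-1 functions of mean 1/2, the two alternatives of
  \<open>between\<close>.\<close>

lemma cospectral_Godsil_McKay_switching:
  fixes V :: "'a::countable set"
  assumes "finite V" and "C \<subseteq> V" and card: "card C = 2 * m" and "m > 0"
    and sym: "\<And>u v. E u v \<longleftrightarrow> E v u" "\<And>u v. F u v \<longleftrightarrow> F v u"
    and inside: "\<And>u v. u \<in> C \<Longrightarrow> v \<in> C \<Longrightarrow> E u v \<longleftrightarrow> F u v"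
    and regular: "\<And>u. u \<in> C \<Longrightarrow> card {w \<in> C. E u w} = d"
    and outside: "\<And>u v. u \<in> V - C \<Longrightarrow> v \<in> V - C \<Longrightarrow> E u v \<longleftrightarrow> F u v"
    and between: "\<And>u. u \<in> V - C \<Longrightarrow>
      (\<forall>w\<in>C. E u w \<longleftrightarrow> F u w) \<and> ((\<forall>w\<in>C. E u w) \<or> (\<forall>w\<in>C. \<not> E u w)) \<or>
      (\<forall>w\<in>C. E u w \<longleftrightarrow> \<not> F u w) \<and> card {w \<in> C. E u w} = m"
  shows "cospectral (coded_graph V E) (coded_graph V F)"
proof (rule cospectral_coded_graph_if_intertwined)
  define q :: "'a \<Rightarrow> 'a \<Rightarrow> complex" where
    "q u v = of_bool (u \<in> C \<and> v \<in> C) / of_nat m + of_bool (u = v) * (if u \<in> C then -1 else 1)"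
    for u v
  have finC: "finite C" using assms(1,2) finite_subset by blast
  \<comment> \<open>\<open>q\<close> is \<open>J / m - I\<close> on \<open>C\<close> and the identity elsewhere.\<close>
  have q_left: "(\<Sum>w\<in>V. q u w * g w) =
      (if u \<in> C then (\<Sum>w\<in>C. g w) / of_nat m - g u else g u)" if "u \<in> V" for u g
  proof -
    have "(\<Sum>w\<in>V. q u w * g w) = (\<Sum>w\<in>V. (if w \<in> C then of_bool (u \<in> C) * g w / of_nat m else 0)
        + (if w = u then (if u \<in> C then -1 else 1) * g u else 0))"
      by (intro sum.cong) (auto simp: q_def field_simps)
    also have "\<dots> = (\<Sum>w\<in>C. of_bool (u \<in> C) * g w / of_nat m) + (if u \<in> C then -1 else 1) * g u"
      using assms(1,2) that by (simp add: sum.distrib sum.inter_restrict[symmetric] Int_absorb1)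
    finally show ?thesis by (simp add: sum_divide_distrib)
  qed
  have q_sym: "q u v = q v u" for u v by (auto simp: q_def)
  have q_right: "(\<Sum>w\<in>V. g w * q w v) =
      (if v \<in> C then (\<Sum>w\<in>C. g w) / of_nat m - g v else g v)" if "v \<in> V" for v g
    using q_left[OF that, of g] by (simp add: q_sym[of v] mult.commute)
  have count: "(\<Sum>w\<in>C. of_bool (P w)) = (of_nat (card {w \<in> C. P w}) :: complex)" for P
    using finC by (simp add: sum.inter_filter[symmetric] of_bool_def)
  show "finite V" by fact
  show "(\<Sum>w\<in>V. q u w * q w v) = of_bool (u = v)" if "u \<in> V" "v \<in> V" for u v
  proof -
    have "(\<Sum>w\<in>C. q w v) = of_bool (v \<in> C)"
    proof (cases "v \<in> C")
      case True
      then have "(\<Sum>w\<in>C. q w v) = (\<Sum>w\<in>C. 1 / of_nat m + (if w = v then -1 else 0))"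
        by (intro sum.cong) (auto simp: q_def)
      also have "\<dots> = 1" using finC True card \<open>m > 0\<close> by (simp add: sum.distrib)
      finally show ?thesis using True by simp
    next
      case False
      then show ?thesis by (auto simp: q_def intro!: sum.neutral)
    qed
    then show ?thesis using that by (auto simp: q_left) (auto simp: q_def)
  qed
  show "(\<Sum>w\<in>V. of_bool (E u w) * q w v) = (\<Sum>w\<in>V. q u w * of_bool (F w v))"
    if uv: "u \<in> V" "v \<in> V" for u v
  proof -
    \<comment> \<open>Twice the mean of the \<open>E\<close>-row of \<open>x\<close> over
      \<open>C\<close> is 2, 0 or 1 in the three cases; subtracting an entry from it keeps that
      entry in the first two and flips it in the third.\<close>
    have cross: "of_nat (card {w \<in> C. E x w}) / of_nat m - of_bool (E x y) = (of_bool (F x y) :: complex)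
        \<and> of_nat (card {w \<in> C. F x w}) / of_nat m - of_bool (F x y) = (of_bool (E x y) :: complex)"
      if x: "x \<in> V - C" and y: "y \<in> C" for x y
      using between[OF x]
    proof (elim disjE conjE)
      assume *: "\<forall>w\<in>C. E x w \<longleftrightarrow> F x w" "\<forall>w\<in>C. E x w"
      then have "{w \<in> C. E x w} = C" "{w \<in> C. F x w} = C" by auto
      then show ?thesis using * y card \<open>m > 0\<close> by simp
    next
      assume *: "\<forall>w\<in>C. E x w \<longleftrightarrow> F x w" "\<forall>w\<in>C. \<not> E x w"
      then have "{w \<in> C. E x w} = {}" "{w \<in> C. F x w} = {}" by auto
      then have "card {w \<in> C. E x w} = 0" "card {w \<in> C. F x w} = 0" by (metis card.empty)+
      moreover have "\<not> E x y" "\<not> F x y" using * y by auto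
      ultimately show ?thesis by simp
    next
      assume *: "\<forall>w\<in>C. E x w \<longleftrightarrow> \<not> F x w" "card {w \<in> C. E x w} = m"
      then have "{w \<in> C. F x w} = C - {w \<in> C. E x w}" by auto
      then have "card {w \<in> C. F x w} = m" using * card finC by (simp add: card_Diff_subset)
      then show ?thesis using * y \<open>m > 0\<close> by auto
    qed
    \<comment> \<open>For two vertices of \<open>C\<close> the products agree because the row sums
      of \<open>E\<close> and the column sums of \<open>F\<close> over \<open>C\<close> are all
      \<open>d\<close>.\<close>
    have "card {w \<in> C. F w v} = d" if "v \<in> C"
    proof -
      have "{w \<in> C. F w v} = {w \<in> C. E v w}" using inside that sym by blast
      then show ?thesis using regular that by simp
    qed
    then show ?thesis
      using uv cross[of u v] cross[of v u] inside[of u v] outside[of u v] sym(1)[of u v]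
      by (auto simp: q_left q_right count regular sym(2)[of _ v])
  qed
qed

section \<open>The two graphs\<close>

datatype vertex = Core nat | Left nat | Aux nat | Right nat | Hub nat nat | Spoke nat nat

instance vertex :: countable
  by countable_datatype

text \<open>Adjacency in the cycle on \<open>{..<b}\<close>; only its being 2-regular and, for the matching, containing
  the edges \<open>01\<close> and \<open>23\<close> matters.\<close>

definition cyc :: "nat \<Rightarrow> nat \<Rightarrow> nat \<Rightarrow> bool" where
  "cyc b i j \<longleftrightarrow>
     j = (if Suc i = b then 0 else Suc i) \<or> i = (if Suc j = b then 0 else Suc j)"

lemma cyc_sym: "cyc b i j \<longleftrightarrow> cyc b j i"
  by (auto simp: cyc_def)

lemma not_cyc_refl [simp]: "b \<ge> 2 \<Longrightarrow> \<not> cyc b i i"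
  by (auto simp: cyc_def split: if_splits)

lemma card_cyc:
  assumes "b \<ge> 3" "i < b"
  shows "card {j \<in> {..<b}. cyc b i j} = 2"
proof -
  have "{j \<in> {..<b}. cyc b i j} =
      {if Suc i = b then 0 else Suc i, if i = 0 then b - 1 else i - 1}"
    using assms by (auto simp: cyc_def split: if_splits)
  \<comment> \<open>Successor and predecessor would coincide for \<open>b = 2\<close>.\<close>
  moreover have "(if Suc i = b then 0 else Suc i) \<noteq> (if i = 0 then b - 1 else i - 1)"
    using assms by auto
  ultimately show ?thesis by (simp only: card_2_iff) blast
qed

lemma card_not_cyc:
  assumes "b \<ge> 3" "i < b"
  shows "card {j \<in> {..<b}. \<not> cyc b i j} = b - 2"
proof -
  have "{j \<in> {..<b}. \<not> cyc b i j} = {..<b} - {j \<in> {..<b}. cyc b i j}" by auto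
  also have "card \<dots> = card {..<b} - card {j \<in> {..<b}. cyc b i j}"
    by (rule card_Diff_subset) auto
  finally show ?thesis by (simp only: card_cyc[OF assms] card_lessThan)
qed

text \<open>The pair containing core vertex 0 is {0,1}, {0,2}, {0,3} for \<open>i\<close> = 0, 1, 2
  and stays {0,3} afterwards. So every other core vertex is the partner of 0 at some
  \<open>i\<close>, as connectivity and the matching require.\<close>

definition joined :: "nat \<Rightarrow> nat \<Rightarrow> bool" where
  "joined k i \<longleftrightarrow> k = 0 \<or> k = min (Suc i) 3"

lemma card_joined: "card {k \<in> {..<4}. joined k i = w} = 2"
proof -
  have *: "{k \<in> {..<4}. joined k i} = {0, min (Suc i) 3}" by (auto simp: joined_def)
  have "{k \<in> {..<4}. \<not> joined k i} = {..<4} - {0, min (Suc i) 3}" by (auto simp: joined_def)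
  moreover have "card ({..<4} - {0, min (Suc i) 3}) = 4 - card {0, min (Suc i) 3}"
    by (subst card_Diff_subset) auto
  ultimately have "card {k \<in> {..<4}. \<not> joined k i} = 2" by simp
  moreover have "card {k \<in> {..<4}. joined k i} = 2" unfolding * by simp
  ultimately show ?thesis by (cases w) simp_all
qed

text \<open>
  \<open>Left\<close> and \<open>Right\<close> are the sets \<open>L\<close> and \<open>R\<close>. Gadget \<open>j\<close> consists of the vertices \<open>Hub j k\<close> with
  \<open>k \<noteq> j\<close> and \<open>Spoke j i\<close>; its extra edge joins the two \<open>Spoke j i\<close> with \<open>i\<close> next to \<open>j\<close> in the cycle.
  The flag \<open>w\<close> selects one of the two switched graphs.
\<close>

fun adj :: "nat \<Rightarrow> bool \<Rightarrow> vertex \<Rightarrow> vertex \<Rightarrow> bool" where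
  "adj b w (Core k) (Left i) \<longleftrightarrow> joined k i = w"
| "adj b w (Left i) (Core k) \<longleftrightarrow> joined k i = w"
| "adj b w (Core k) (Right i) \<longleftrightarrow> joined k i \<noteq> w"
| "adj b w (Right i) (Core k) \<longleftrightarrow> joined k i \<noteq> w"
| "adj b w (Left i) (Aux j) \<longleftrightarrow> \<not> cyc b i j"
| "adj b w (Aux j) (Left i) \<longleftrightarrow> \<not> cyc b i j"
| "adj b w (Aux i) (Aux j) \<longleftrightarrow> cyc b i j"
| "adj b w (Right i) (Spoke j i') \<longleftrightarrow> i = i' \<and> \<not> cyc b j i"
| "adj b w (Spoke j i') (Right i) \<longleftrightarrow> i = i' \<and> \<not> cyc b j i"
| "adj b w (Hub j k) (Spoke j' i) \<longleftrightarrow> j = j'"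
| "adj b w (Spoke j' i) (Hub j k) \<longleftrightarrow> j = j'"
| "adj b w (Spoke j i) (Spoke j' i') \<longleftrightarrow> j = j' \<and> i \<noteq> i' \<and> cyc b j i \<and> cyc b j i'"
| "adj b w _ _ \<longleftrightarrow> False"

definition gadget :: "nat \<Rightarrow> nat \<Rightarrow> vertex set" where
  "gadget b j = Hub j ` ({..<b} - {j}) \<union> Spoke j ` {..<b}"

definition vertices :: "nat \<Rightarrow> vertex set" where
  "vertices b = Core ` {..<4} \<union> Left ` {..<b} \<union> Aux ` {..<b} \<union> Right ` {..<b} \<union>
     (\<Union>j<b. gadget b j)"

lemma in_vertices [simp]:
  "Core k \<in> vertices b \<longleftrightarrow> k < 4" "Left i \<in> vertices b \<longleftrightarrow> i < b" "Aux i \<in> vertices b \<longleftrightarrow> i < b"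
  "Right i \<in> vertices b \<longleftrightarrow> i < b" "Hub j k \<in> vertices b \<longleftrightarrow> j < b \<and> k < b \<and> k \<noteq> j"
  "Spoke j i \<in> vertices b \<longleftrightarrow> j < b \<and> i < b"
  by (auto simp: vertices_def gadget_def)

lemma finite_vertices [simp]: "finite (vertices b)"
  by (simp add: vertices_def gadget_def)

lemma adj_sym: "adj b w u v \<longleftrightarrow> adj b w v u"
  by (cases u; cases v) (auto simp: cyc_sym)

lemma adj_irrefl: "b \<ge> 2 \<Longrightarrow> \<not> adj b w u u"
  by (cases u) auto

lemma pair_graph_adj:
  assumes "b \<ge> 2"
  shows "pair_graph (coded_graph (vertices b) (adj b w))"
proof (rule pair_graph_coded_graph)
  show "adj b w v u" if "adj b w u v" for u v using that adj_sym by blast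
qed (use assms adj_irrefl in simp_all)

section \<open>Degrees and connectivity\<close>

lemma card_Un_images:
  assumes "N = f ` P \<union> g ` Q" and "card P + card Q = n" and "finite P" "finite Q"
    and "\<And>x y. f x = f y \<Longrightarrow> x = y" "\<And>x y. g x = g y \<Longrightarrow> x = y" "\<And>x y. f x \<noteq> g y"
  shows "card N = n"
proof -
  have "card (f ` P \<union> g ` Q) = card (f ` P) + card (g ` Q)"
    using assms by (intro card_Un_disjoint) auto
  moreover have "card (f ` P) = card P" "card (g ` Q) = card Q"
    using assms(5,6) by (meson card_image inj_onI)+
  ultimately show ?thesis using assms(1,2) by simp
qed

lemma vertex_set_eqI:
  assumes "\<And>k. Core k \<in> A \<longleftrightarrow> Core k \<in> B" "\<And>i. Left i \<in> A \<longleftrightarrow> Left i \<in> B"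
    "\<And>i. Aux i \<in> A \<longleftrightarrow> Aux i \<in> B" "\<And>i. Right i \<in> A \<longleftrightarrow> Right i \<in> B"
    "\<And>j k. Hub j k \<in> A \<longleftrightarrow> Hub j k \<in> B" "\<And>j i. Spoke j i \<in> A \<longleftrightarrow> Spoke j i \<in> B"
  shows "A = B"
proof (intro equalityI subsetI)
  show "v \<in> B" if "v \<in> A" for v using that assms by (cases v) auto
  show "v \<in> A" if "v \<in> B" for v using that assms by (cases v) auto
qed

text \<open>A core vertex sees exactly one of \<open>Left i\<close> and \<open>Right i\<close> for
  each \<open>i\<close>. \<open>Left\<close>, \<open>Aux\<close> and \<open>Right\<close> vertices
  have degree 2 + (b - 2), hubs see the \<open>b\<close> spokes of their gadget, and spokes see
  \<open>b - 1\<close> hubs and one further vertex.\<close>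

lemma degree_adj:
  assumes b: "b \<ge> 3" and v: "v \<in> vertices b"
  shows "card {u \<in> vertices b. adj b w v u} = b"
proof (cases v)
  case (Core k)
  show ?thesis
  proof (rule card_Un_images)
    show "{u \<in> vertices b. adj b w v u} =
        Left ` {i \<in> {..<b}. joined k i = w} \<union> Right ` {i \<in> {..<b}. joined k i \<noteq> w}"
      using v Core by (intro vertex_set_eqI) auto
    have "card {i \<in> {..<b}. joined k i = w} + card {i \<in> {..<b}. joined k i \<noteq> w} =
        card ({i \<in> {..<b}. joined k i = w} \<union> {i \<in> {..<b}. joined k i \<noteq> w})"
      by (rule card_Un_disjoint[symmetric]) auto
    also have "{i \<in> {..<b}. joined k i = w} \<union> {i \<in> {..<b}. joined k i \<noteq> w} = {..<b}" by auto
    finally show "card {i \<in> {..<b}. joined k i = w} + card {i \<in> {..<b}. joined k i \<noteq> w} = b" by simp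
  qed auto
next
  case (Left i)
  show ?thesis
  proof (rule card_Un_images)
    show "{u \<in> vertices b. adj b w v u} =
        Core ` {k \<in> {..<4}. joined k i = w} \<union> Aux ` {j \<in> {..<b}. \<not> cyc b i j}"
      using v Left by (intro vertex_set_eqI) auto
    show "card {k \<in> {..<4}. joined k i = w} + card {j \<in> {..<b}. \<not> cyc b i j} = b"
      unfolding card_joined using v Left b by (subst card_not_cyc) auto
  qed auto
next
  case (Aux i)
  show ?thesis
  proof (rule card_Un_images)
    show "{u \<in> vertices b. adj b w v u} =
        Left ` {j \<in> {..<b}. \<not> cyc b i j} \<union> Aux ` {j \<in> {..<b}. cyc b i j}"
      using v Aux by (intro vertex_set_eqI) (auto simp: cyc_sym)
    show "card {j \<in> {..<b}. \<not> cyc b i j} + card {j \<in> {..<b}. cyc b i j} = b"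
      using card_not_cyc[OF b, of i] card_cyc[OF b, of i] v Aux b by simp
  qed auto
next
  case (Right i)
  show ?thesis
  proof (rule card_Un_images)
    show "{u \<in> vertices b. adj b w v u} =
        Core ` {k \<in> {..<4}. joined k i = (\<not> w)} \<union> (\<lambda>j. Spoke j i) ` {j \<in> {..<b}. \<not> cyc b i j}"
      using v Right by (intro vertex_set_eqI) (auto simp: cyc_sym)
    show "card {k \<in> {..<4}. joined k i = (\<not> w)} + card {j \<in> {..<b}. \<not> cyc b i j} = b"
      unfolding card_joined using v Right b by (subst card_not_cyc) auto
  qed auto
next
  case (Hub j k)
  have "{u \<in> vertices b. adj b w v u} = Spoke j ` {..<b}"
    using v Hub by (intro vertex_set_eqI) auto
  then show ?thesis by (simp add: card_image inj_on_def)
next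
  case (Spoke j i)
  show ?thesis
  proof (cases "cyc b j i")
    case True
    show ?thesis
    proof (rule card_Un_images)
      show "{u \<in> vertices b. adj b w v u} =
          Hub j ` ({..<b} - {j}) \<union> Spoke j ` ({i' \<in> {..<b}. cyc b j i'} - {i})"
        using v Spoke True by (intro vertex_set_eqI) auto
      \<comment> \<open>The other end of the gadget's extra edge takes the place of a neighbour in
        \<open>Right\<close>.\<close>
      have "card ({i' \<in> {..<b}. cyc b j i'} - {i}) = 1"
        using card_cyc[OF b, of j] v Spoke True by simp
      then show "card ({..<b} - {j}) + card ({i' \<in> {..<b}. cyc b j i'} - {i}) = b"
        using v Spoke by simp
    qed auto
  next
    case False
    show ?thesis
    proof (rule card_Un_images)
      show "{u \<in> vertices b. adj b w v u} = Hub j ` ({..<b} - {j}) \<union> Right ` {i}"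
        using v Spoke False by (intro vertex_set_eqI) auto
      show "card ({..<b} - {j}) + card {i} = b" using v Spoke by simp
    qed auto
  qed
qed

lemma connected_adj:
  assumes b: "b \<ge> 3"
  shows "Digraph_Component.connected (with_proj (coded_graph (vertices b) (adj b w)))"
proof (rule connected_coded_graph)
  show "Core 0 \<in> vertices b" by simp
  show "adj b w v u" if "adj b w u v" for u v using that adj_sym by blast
  fix W
  assume "Core 0 \<in> W"
    and step: "\<And>u v. u \<in> W \<Longrightarrow> u \<in> vertices b \<Longrightarrow> v \<in> vertices b \<Longrightarrow> adj b w u v \<Longrightarrow> v \<in> W"
  \<comment> \<open>\<open>D\<close> is the side receiving the pairs that contain
    \<open>Core 0\<close>, so for either value of \<open>w\<close> all its vertices are adjacent to
    \<open>Core 0\<close>.\<close>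
  define D where "D = (if w then Left else Right)"
  define D' where "D' = (if w then Right else Left)"
  have D_Core: "D i \<in> W \<longleftrightarrow> Core k \<in> W" if "joined k i" "k < 4" "i < b" for i k
    using that step[of "D i" "Core k"] step[of "Core k" "D i"] by (auto simp: D_def)
  have D'_Core: "D' i \<in> W" if "\<not> joined k i" "k < 4" "i < b" "Core k \<in> W" for i k
    using that step[of "Core k" "D' i"] by (auto simp: D'_def)
  have D: "D i \<in> W" if "i < b" for i
    using that D_Core[of 0 i] \<open>Core 0 \<in> W\<close> by (simp add: joined_def)
  \<comment> \<open>For positive \<open>k\<close> the pair at \<open>k - 1\<close> is {0,k}.\<close>
  have Core: "Core k \<in> W" if "k < 4" for k
    using that b D[of "k - 1"] D_Core[of k "k - 1"] \<open>Core 0 \<in> W\<close>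
    by (cases "k = 0") (auto simp: joined_def)
  \<comment> \<open>Core vertex 2 is outside the pair {0,1} at \<open>i = 0\<close>; core vertex 1
    is outside all later pairs.\<close>
  have "D' i \<in> W" if "i < b" for i
    using that D'_Core[of "if i = 0 then 2 else 1" i] Core by (simp add: joined_def)
  then have Left: "Left i \<in> W" and Right: "Right i \<in> W" if "i < b" for i
    using D that by (cases w; simp add: D_def D'_def)+
  have Aux: "Aux i \<in> W" if "i < b" for i
    using that b Left step[of "Left i" "Aux i"] by simp
  have "Spoke j j \<in> W" if "j < b" for j
    using that b Right step[of "Right j" "Spoke j j"] by simp
  then have Hub: "Hub j k \<in> W" if "j < b" "k < b" "k \<noteq> j" for j k
    using that b step[of "Spoke j j" "Hub j k"] by simp
  have Spoke: "Spoke j i \<in> W" if "j < b" "i < b" for j i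
    using that b Hub[of j "if j = 0 then 1 else 0"]
      step[of "Hub j (if j = 0 then 1 else 0)" "Spoke j i"] by (simp split: if_splits)
  show "vertices b \<subseteq> W"
  proof
    fix v assume "v \<in> vertices b"
    then show "v \<in> W" using Core Left Aux Right Hub Spoke by (cases v) auto
  qed
qed

section \<open>Cospectrality and matchings of the two graphs\<close>

lemma cospectral_adj:
  assumes b: "b \<ge> 3"
  shows "cospectral (coded_graph (vertices b) (adj b True)) (coded_graph (vertices b) (adj b False))"
proof (rule cospectral_Godsil_McKay_switching)
  let ?C = "Core ` {..<4}"
  show "?C \<subseteq> vertices b" by auto
  show "card ?C = 2 * 2" by (simp add: card_image inj_on_def)
  \<comment> \<open>The core spans no edge, so it is regular of degree 0.\<close>
  show "card {w \<in> ?C. adj b True u w} = 0" if "u \<in> ?C" for u using that by auto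
  show "adj b True u v \<longleftrightarrow> adj b False u v" if "u \<in> vertices b - ?C" "v \<in> vertices b - ?C" for u v
    using that by (cases u; cases v) auto
  have card_Core: "card {v \<in> ?C. P v} = card {k \<in> {..<4}. P (Core k)}" for P
  proof -
    have "{v \<in> ?C. P v} = Core ` {k \<in> {..<4}. P (Core k)}" by auto
    then show ?thesis by (simp only: card_image inj_on_def vertex.inject) (simp add: card_image inj_on_def)
  qed
  show "(\<forall>w\<in>?C. adj b True u w \<longleftrightarrow> adj b False u w) \<and>
        ((\<forall>w\<in>?C. adj b True u w) \<or> (\<forall>w\<in>?C. \<not> adj b True u w)) \<or>
      (\<forall>w\<in>?C. adj b True u w \<longleftrightarrow> \<not> adj b False u w) \<and> card {w \<in> ?C. adj b True u w} = 2"
    if "u \<in> vertices b - ?C" for u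
  proof (cases u)
    case (Left i)
    have "card {w \<in> ?C. adj b True u w} = card {k \<in> {..<4}. joined k i = True}"
      unfolding card_Core Left by simp
    then show ?thesis unfolding card_joined using Left by auto
  next
    case (Right i)
    have "card {w \<in> ?C. adj b True u w} = card {k \<in> {..<4}. joined k i = False}"
      unfolding card_Core Right by simp
    then show ?thesis unfolding card_joined using Right by auto
  qed (use that in auto)
  show "adj b True u v \<longleftrightarrow> adj b True v u" "adj b False u v \<longleftrightarrow> adj b False v u" for u v
    by (rule adj_sym)+
  show "adj b True u v \<longleftrightarrow> adj b False u v" if "u \<in> ?C" "v \<in> ?C" for u v
    using that by auto
qed simp_all

lemma has_perfect_matching_adj:
  assumes b: "b \<ge> 4"
  shows "has_perfect_matching (coded_graph (vertices b) (adj b True))"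
proof (rule has_perfect_matching_coded_graphI)
  \<comment> \<open>The core takes \<open>Left 0\<close> to \<open>Left 3\<close>; the aux vertices
    0 to 3 thus left over are paired along the cycle edges 01 and 23, and each later
    \<open>Left i\<close> takes \<open>Aux i\<close>. In gadget \<open>j\<close>,
    \<open>Right j\<close> takes \<open>Spoke j j\<close>, and the remaining spokes pair with the
    hubs of the same index.\<close>
  define p where "p v = (case v of
      Core k \<Rightarrow> Left (if k = 0 then 3 else k - 1)
    | Left i \<Rightarrow> if i < 3 then Core (Suc i) else if i = 3 then Core 0 else Aux i
    | Aux i \<Rightarrow> if i < 4 then Aux (if even i then Suc i else i - 1) else Left i
    | Right i \<Rightarrow> Spoke i i
    | Hub j k \<Rightarrow> Spoke j k
    | Spoke j i \<Rightarrow> if i = j then Right i else Hub j i)" for v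
  fix v assume v: "v \<in> vertices b"
  have pair: "i < 4 \<Longrightarrow> i = 0 \<or> i = 1 \<or> i = 2 \<or> i = (3::nat)" for i by auto
  show "p v \<in> vertices b" using v b by (cases v) (auto simp: p_def dest!: pair)
  show "p (p v) = v" using v b by (cases v) (auto simp: p_def dest!: pair)
  show "adj b True v (p v)"
    using v b by (cases v) (auto simp: p_def joined_def dest!: pair, auto simp: cyc_def)
qed

lemma card_gadget: "j < b \<Longrightarrow> card (gadget b j) = 2 * b - 1"
  by (rule card_Un_images[OF gadget_def]) auto

lemma no_perfect_matching_adj:
  assumes b: "b \<ge> 2"
  shows "\<not> has_perfect_matching (coded_graph (vertices b) (adj b False))"
proof
  let ?G = "coded_graph (vertices b) (adj b False)"
  \<comment> \<open>Index \<open>b\<close> stands for the isolated core vertex, giving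
    \<open>b + 1\<close> odd parts against the \<open>b\<close> vertices of
    \<open>Right\<close>.\<close>
  define U where "U j = (if j < b then gadget b j else {Core 0})" for j
  assume "has_perfect_matching ?G"
  then have "card {..b} \<le> card (to_nat ` Right ` {..<b})"
  proof (rule card_odd_parts_le[OF pair_graph_adj[OF b], where U = "\<lambda>j. to_nat ` U j"])
    show "to_nat ` Right ` {..<b} \<subseteq> pverts ?G" by auto
    show "to_nat ` U j \<subseteq> pverts ?G - to_nat ` Right ` {..<b}" for j
      by (auto simp: U_def gadget_def)
    show "odd (card (to_nat ` U j))" for j
      using b by (auto simp: U_def card_image card_gadget)
    show "disjoint_family_on (\<lambda>j. to_nat ` U j) {..b}"
      by (auto simp: disjoint_family_on_def U_def gadget_def)
    fix j x y assume "j \<in> {..b}" "x \<in> to_nat ` U j" "(x, y) \<in> parcs ?G"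
    then obtain u v where uv: "x = to_nat u" "y = to_nat v" "u \<in> U j"
      "u \<in> vertices b" "v \<in> vertices b" "adj b False u v"
      by (auto elim!: parcs_coded_graphE)
    then have "v \<in> U j \<union> Right ` {..<b}"
      by (cases v) (auto simp: U_def gadget_def joined_def split: if_splits)
    then show "y \<in> to_nat ` U j \<union> to_nat ` Right ` {..<b}" using uv by auto
  qed
  also have "\<dots> = b" by (simp add: card_image inj_on_def)
  finally show False by simp
qed

theorem mainTheorem1:
  fixes b :: nat
  assumes "b \<ge> 5"
  shows "\<exists>(G :: nat pair_pre_digraph) (G' :: nat pair_pre_digraph).
    pair_graph G \<and> pair_graph G' \<and>
    Digraph_Component.connected (with_proj G) \<and> Digraph_Component.connected (with_proj G') \<and>
    regular_graph b G \<and> regular_graph b G' \<and>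
    cospectral G G' \<and>
    (has_perfect_matching G \<noteq> has_perfect_matching G')"
proof -
  have regular: "regular_graph b (coded_graph (vertices b) (adj b w))" for w
    using assms by (intro regular_coded_graph degree_adj) auto
  show ?thesis
    using assms pair_graph_adj connected_adj regular cospectral_adj
      has_perfect_matching_adj no_perfect_matching_adj
    by (intro exI[of _ "coded_graph (vertices b) (adj b True)"]
        exI[of _ "coded_graph (vertices b) (adj b False)"]) auto
qed

end
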